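(* Let $\ell\ge 1$ be a fixed integer. Suppose there is a sequence of reals $(\alpha_j)_{j\ge1}$ with $\alpha_j\ge 1$ and $\alpha_j\to\infty$ such that, for each $j$, there exist a constant $c_j>0$ and an infinite sequence $(G_{j,i})_{i\ge1}$, where $G_{j,i}$ is an $(m_i,n_i,a_i,b_i)$-graph (parameters depending on $j$ as well) with $a_i\ge 2$, of girth larger than $4\ell+2$, with at least $c_j(m_in_i)^{(\ell+1)/(2\ell+1)}$ edges, with $n_i\to\infty$ and $\log_{a_i}b_i\to\alpha_j$ as $i\to\infty$. Then, for any $\epsilon>0$, $$r(C_{2\ell+1},t)\ \ge\ t^{(\ell+1)/\ell-\epsilon}$$ for infinitely many positive integers $t$.
   Context: All graphs are finite and simple; $C_k$ is the cycle of length $k$. For a graph $F$ and an integer $t\ge 2$, $r(F,t)$ is the minimum $N$ such that every $N$-vertex $F$-free graph (no subgraph isomorphic to $F$, not necessarily induced) contains an independent set of order $t$. An $(m,n,a,b)$-graph is a bipartite graph with parts of orders $m$ and $n$, where $n\ge m$, such that all vertices in the part of size $n$ have degree $a$ and all vertices in the part of size $m$ have degree $b\ge a$. The girth of a graph is the length of its shortest cycle (infinite if there is none). *)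

theory Defs
  imports Complex_Main "HOL-Library.Ramsey" "HOL-Library.Extended_Nat"
begin

type_synonym 'a ugraph = "'a set \<times> 'a set set"

abbreviation vertices :: "'a ugraph \<Rightarrow> 'a set" where
  "vertices G \<equiv> fst G"

abbreviation edges :: "'a ugraph \<Rightarrow> 'a set set" where
  "edges G \<equiv> snd G"

definition simple_graph :: "'a ugraph \<Rightarrow> bool" where
  "simple_graph G \<longleftrightarrow> finite (vertices G) \<and> edges G \<subseteq> [vertices G]\<^bsup>2\<^esup>"

definition vertex_degree :: "'a ugraph \<Rightarrow> 'a \<Rightarrow> nat" where
  "vertex_degree G v = card {e \<in> edges G. v \<in> e}"

definition contains_copy :: "'a ugraph \<Rightarrow> 'b ugraph \<Rightarrow> bool" where
  "contains_copy G F \<longleftrightarrow>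
     (\<exists>f. inj_on f (vertices F) \<and> f ` vertices F \<subseteq> vertices G \<and>
          (\<forall>e \<in> edges F. f ` e \<in> edges G))"

(* This is the k-cycle only for k >= 3. *)
definition cycle_graph :: "nat \<Rightarrow> nat ugraph" where
  "cycle_graph k = ({..<k}, {{i, Suc i mod k} | i. i < k})"

(* In enat the infimum of the empty set is \<infinity>, the girth of a forest. *)
definition girth :: "'a ugraph \<Rightarrow> enat" where
  "girth G = Inf {enat k | k. k \<ge> 3 \<and> contains_copy G (cycle_graph k)}"

(* Since all graphs are finite, it is enough to range over graphs with vertices in nat.
   The minimum exists by Ramsey's theorem. *)
definition ramsey_number :: "'a ugraph \<Rightarrow> nat \<Rightarrow> nat" where
  "ramsey_number F t =
     (LEAST N. \<forall>G :: nat ugraph.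
        simple_graph G \<and> card (vertices G) = N \<and> \<not> contains_copy G F \<longrightarrow>
        (\<exists>I \<subseteq> vertices G. card I = t \<and> indep I (edges G)))"

definition mnab_graph :: "nat \<Rightarrow> nat \<Rightarrow> nat \<Rightarrow> nat \<Rightarrow> 'a ugraph \<Rightarrow> bool" where
  "mnab_graph m n a b G \<longleftrightarrow>
     simple_graph G \<and> m \<le> n \<and> a \<le> b \<and>
     (\<exists>A B. A \<union> B = vertices G \<and> A \<inter> B = {} \<and> card A = m \<and> card B = n \<and>
        (\<forall>e \<in> edges G. \<exists>x \<in> A. \<exists>y \<in> B. e = {x, y}) \<and>
        (\<forall>y \<in> B. vertex_degree G y = a) \<and>
        (\<forall>x \<in> A. vertex_degree G x = b))"

end

theory Submission
  imports Defs "HOL-Real_Asymp.Real_Asymp"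
begin

text \<open>
  Let \<open>G\<close> be one of the given bipartite graphs, with parts \<open>A\<close> and \<open>B\<close> of sizes \<open>m\<close> and \<open>n\<close>.
  Split the neighbourhood of every \<open>x \<in> A\<close> at random into two sides, and let \<open>H\<close> be the
  graph on \<open>B\<close> formed by the complete bipartite graphs between the two sides. A cycle of length
  \<open>2 * l + 1\<close> in \<open>H\<close> takes its edges from at least two neighbourhoods, since it is odd, so it
  lifts to a closed walk in \<open>G\<close> containing a cycle of length at most \<open>4 * l + 2\<close>
  (\<open>short_cycle_of_closed_chain\<close>). The girth condition excludes this.

  A fixed set of \<open>t\<close> vertices is independent in \<open>H\<close> with probability at most \<open>2 ^ (m - a * t)\<close>,
  because it can only meet one side of each neighbourhood. There are at most \<open>n ^ t\<close> such sets, so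
  \<open>n ^ t * 2 ^ m < 2 ^ (a * t)\<close> gives an \<open>H\<close> without independent sets of order \<open>t\<close>
  (\<open>exists_splitting\<close>), and the Ramsey number exceeds \<open>n\<close>
  (\<open>ramsey_number_greater_of_bipartite\<close>).

  The inequality holds for a \<open>t\<close> just above \<open>2 * m / a = 2 * n / b\<close> once \<open>a\<close> is at least twice the
  binary logarithm of \<open>n\<close>. The density of \<open>G\<close> guarantees that, and it also shows that
  \<open>n\<close> is at least of order \<open>t powr ((l + 1) / l - 1 / (l * (\<beta> + 1)))\<close>, where \<open>b = a powr \<beta>\<close>. As \<open>\<beta>\<close>
  can be taken arbitrarily large, the loss in the exponent is eventually below \<open>\<epsilon>\<close>
  (\<open>eventually_parameters\<close>).
\<close>

section \<open>Lower bounds for Ramsey numbers\<close>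

lemma clique_contains_copy:
  assumes F: "simple_graph F" and "finite R" "R \<subseteq> vertices G" "clique R (edges G)"
    and card: "card R = card (vertices F)"
  shows "contains_copy G F"
proof -
  have "finite (vertices F)" using F by (simp add: simple_graph_def)
  then obtain f where f: "bij_betw f (vertices F) R"
    using finite_same_card_bij[of "vertices F" R] assms by metis
  have "f ` e \<in> edges G" if "e \<in> edges F" for e
  proof -
    from that F have "e \<in> [vertices F]\<^bsup>2\<^esup>" by (auto simp: simple_graph_def)
    then obtain u v where "e = {u, v}" "u \<noteq> v" "u \<in> vertices F" "v \<in> vertices F"
      by (auto simp: nsets_def card_2_iff)
    then show ?thesis
      using f \<open>clique R (edges G)\<close> by (auto simp: clique_def bij_betw_def inj_on_def)
  qed
  then show ?thesis
    using f assms(3) by (auto simp: contains_copy_def bij_betw_def)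
qed

text \<open>
  Two points have to be settled before a graph on an arbitrary vertex type bounds the least
  element in the definition of \<^const>\<open>ramsey_number\<close>: that some number qualifies (Ramsey's
  theorem, as a clique on \<open>card (vertices F)\<close> vertices contains \<open>F\<close>), and that a graph with more
  vertices than the least such number is still excluded (pass to an induced subgraph).
\<close>
lemma ramsey_number_greater:
  fixes H :: "'a ugraph" and F :: "'b ugraph"
  assumes F: "simple_graph F" and H: "simple_graph H" and free: "\<not> contains_copy H F"
    and no_indep: "\<And>I. I \<subseteq> vertices H \<Longrightarrow> card I = t \<Longrightarrow> \<not> indep I (edges H)"
  shows "ramsey_number F t > card (vertices H)"
proof (rule ccontr)
  assume small: "\<not> ?thesis"
  define P where "P = (\<lambda>N. \<forall>G :: nat ugraph.
        simple_graph G \<and> card (vertices G) = N \<and> \<not> contains_copy G F \<longrightarrow>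
        (\<exists>I \<subseteq> vertices G. card I = t \<and> indep I (edges G)))"
  obtain r where r: "\<And>(V::nat set) E. finite V \<Longrightarrow> card V \<ge> r \<Longrightarrow>
      \<exists>R \<subseteq> V. card R = card (vertices F) \<and> clique R E \<or> card R = t \<and> indep R E"
    using ramsey2[of "card (vertices F)" t, where 'a = nat] by auto
  have "P r"
    unfolding P_def
  proof (intro allI impI)
    fix G :: "nat ugraph"
    assume G: "simple_graph G \<and> card (vertices G) = r \<and> \<not> contains_copy G F"
    then have fin: "finite (vertices G)" by (simp add: simple_graph_def)
    then obtain R where R: "R \<subseteq> vertices G"
      "card R = card (vertices F) \<and> clique R (edges G) \<or> card R = t \<and> indep R (edges G)"
      using r[of "vertices G" "edges G"] G by auto
    moreover have "finite R" using R(1) fin by (rule finite_subset)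
    ultimately show "\<exists>I\<subseteq>vertices G. card I = t \<and> indep I (edges G)"
      using clique_contains_copy[OF F] G by blast
  qed
  define N where "N = ramsey_number F t"
  have "P N"
  proof -
    have "N = (LEAST N. P N)" unfolding N_def ramsey_number_def P_def ..
    then show ?thesis using LeastI[of P, OF \<open>P r\<close>] by metis
  qed
  have "N \<le> card (vertices H)"
    using small by (simp add: N_def)
  then obtain W where W: "W \<subseteq> vertices H" "card W = N" "finite W"
    by (rule obtain_subset_with_card_n)
  obtain g where g: "bij_betw g W {..<N}"
    using finite_same_card_bij[of W "{..<N}"] W by auto
  define h where "h = inv_into W g"
  have h: "bij_betw h {..<N} W"
    unfolding h_def using g by (rule bij_betw_inv_into)
  \<comment> \<open>\<open>G\<close> is an isomorphic copy, on \<open>{..<N}\<close>, of the subgraph induced by \<open>W\<close>.\<close>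
  define G where "G = ({..<N}, {e \<in> [{..<N}]\<^bsup>2\<^esup>. h ` e \<in> edges H})"
  have "simple_graph G" "card (vertices G) = N"
    by (auto simp: G_def simple_graph_def)
  moreover have "\<not> contains_copy G F"
  proof
    assume "contains_copy G F"
    then obtain f where f: "inj_on f (vertices F)" "f ` vertices F \<subseteq> {..<N}"
      "\<And>e. e \<in> edges F \<Longrightarrow> h ` f ` e \<in> edges H"
      by (auto simp: contains_copy_def G_def)
    have "inj_on (h \<circ> f) (vertices F)"
      using f h by (meson bij_betw_imp_inj_on comp_inj_on inj_on_subset)
    moreover have "(h \<circ> f) ` vertices F \<subseteq> vertices H"
      using f h W(1) by (auto simp: bij_betw_def)
    ultimately have "contains_copy H F"
      using f(3) unfolding contains_copy_def by (intro exI[of _ "h \<circ> f"]) (auto simp: image_comp)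
    then show False using free by simp
  qed
  ultimately have "\<exists>I\<subseteq>vertices G. card I = t \<and> indep I (edges G)"
    using \<open>P N\<close> unfolding P_def by blast
  then obtain I where I: "I \<subseteq> {..<N}" "card I = t" "indep I (edges G)"
    by (auto simp: G_def)
  have inj: "inj_on h I"
    using h I(1) by (meson bij_betw_imp_inj_on inj_on_subset)
  have "h ` I \<subseteq> vertices H" using h I(1) W(1) by (auto simp: bij_betw_def)
  moreover have "card (h ` I) = t" using inj I(2) by (simp add: card_image)
  moreover have "indep (h ` I) (edges H)"
    unfolding indep_def
  proof (intro ballI impI)
    fix u v assume "u \<in> h ` I" "v \<in> h ` I" "u \<noteq> v"
    then obtain i j where ij: "i \<in> I" "j \<in> I" "i \<noteq> j" "u = h i" "v = h j" by auto
    then have "{i, j} \<in> [{..<N}]\<^bsup>2\<^esup>" "{i, j} \<notin> edges G"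
      using I by (auto simp: nsets_def indep_def)
    then show "{u, v} \<notin> edges H"
      using ij by (simp add: G_def)
  qed
  ultimately show False using no_indep by blast
qed

section \<open>Short cycles from closed walks\<close>

lemma simple_graph_cycle_graph:
  assumes "k \<ge> 2"
  shows "simple_graph (cycle_graph k)"
proof -
  have "Suc i mod k \<noteq> i" if "i < k" for i
    using that assms by (cases "Suc i = k") auto
  then show ?thesis
    using assms by (auto simp: simple_graph_def cycle_graph_def nsets_def card_2_iff)
qed

text \<open>
  A list of pairs \<open>(y, x)\<close> with \<open>y \<in> B\<close> and \<open>x \<in> A\<close> encodes the closed walk that visits the
  first and the second component of each pair in turn. The relation in the premise on
  \<^const>\<open>successively\<close> supplies the edge from \<open>x\<close> to the first component of the next pair;
  appending the head of the list closes the walk.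
\<close>
lemma contains_cycle_of_distinct_chain:
  fixes G :: "'a ugraph"
  assumes "A \<inter> B = {}" "A \<union> B \<subseteq> vertices G"
    and "distinct (map fst ps)" "distinct (map snd ps)"
    and "set ps \<subseteq> B \<times> A" "\<forall>p \<in> set ps. {fst p, snd p} \<in> edges G"
    and succ: "successively (\<lambda>p q. {fst q, snd p} \<in> edges G) (ps @ [hd ps])"
    and len: "length ps \<ge> 2"
  shows "contains_copy G (cycle_graph (2 * length ps))"
proof -
  define k where "k = length ps"
  define f where "f i = (if even i then fst (ps ! (i div 2)) else snd (ps ! (i div 2)))" for i
  have mem: "fst (ps ! i) \<in> B" "snd (ps ! i) \<in> A" if "i < k" for i
  proof -
    have "ps ! i \<in> B \<times> A"
      using that assms(5) by (auto simp: k_def dest: nth_mem)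
    then show "fst (ps ! i) \<in> B" "snd (ps ! i) \<in> A" by auto
  qed
  \<comment> \<open>Parity is determined by the part containing the vertex, and distinctness in each part does the rest.\<close>
  have inj: "inj_on f {..<2 * k}"
  proof (rule inj_onI)
    fix i j assume ij: "i \<in> {..<2 * k}" "j \<in> {..<2 * k}" "f i = f j"
    then have *: "i div 2 < k" "j div 2 < k" by auto
    then have par: "even i \<longleftrightarrow> even j"
      using ij(3) mem[OF *(1)] mem[OF *(2)] assms(1) unfolding f_def
      by (auto split: if_splits)
    have "i div 2 = j div 2"
      using ij(3) par * assms(3,4) unfolding f_def k_def
      by (auto split: if_splits simp: distinct_conv_nth)
    then show "i = j" using par by (metis bit_eq_rec)
  qed
  have next_edge: "{fst (ps ! (Suc i mod k)), snd (ps ! i)} \<in> edges G" if "i < k" for i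
  proof -
    have "{fst ((ps @ [hd ps]) ! Suc i), snd ((ps @ [hd ps]) ! i)} \<in> edges G"
      using succ that successively_nth[of _ "ps @ [hd ps]" i] by (simp add: k_def)
    moreover have "ps \<noteq> []" using len by auto
    then have "(ps @ [hd ps]) ! Suc i = ps ! (Suc i mod k)"
      using that by (cases "Suc i = k") (auto simp: nth_append k_def hd_conv_nth)
    ultimately show ?thesis using that by (simp add: nth_append k_def)
  qed
  have "f ` {i, Suc i mod (2 * k)} \<in> edges G" if i: "i < 2 * k" for i
  proof (cases "even i")
    case True
    then obtain j where j: "i = 2 * j" by auto
    then have "j < k" "Suc i mod (2 * k) = 2 * j + 1" using i by auto
    moreover have "{fst (ps ! j), snd (ps ! j)} \<in> edges G"
      using assms(6) \<open>j < k\<close> by (simp add: k_def)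
    ultimately show ?thesis by (simp add: f_def j insert_commute)
  next
    case False
    then obtain j where j: "i = 2 * j + 1" by (auto elim: oddE)
    then have "j < k" using i by auto
    moreover have "Suc i mod (2 * k) = 2 * (Suc j mod k)"
      by (simp add: j mult_mod_right)
    ultimately show ?thesis
      using next_edge[of j] by (simp add: f_def j insert_commute)
  qed
  moreover have "f ` {..<2 * k} \<subseteq> vertices G"
    using mem assms(2) by (auto simp: f_def)
  ultimately show ?thesis
    using inj unfolding contains_copy_def cycle_graph_def k_def[symmetric]
    by (intro exI[of _ f]) auto
qed

text \<open>
  If only the first components are known to be distinct, the walk still contains a cycle unless it
  keeps returning to a single vertex of \<open>A\<close>. A repeated second component cuts the walk
  into two shorter closed walks, to one of which induction applies.
\<close>
lemma short_cycle_of_closed_chain: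
  fixes G :: "'a ugraph"
  assumes "A \<inter> B = {}" "A \<union> B \<subseteq> vertices G"
    and "distinct (map fst ps)"
    and "set ps \<subseteq> B \<times> A" "\<forall>p \<in> set ps. {fst p, snd p} \<in> edges G"
    and "successively (\<lambda>p q. {fst q, snd p} \<in> edges G) (ps @ [hd ps])"
    and "p \<in> set ps" "q \<in> set ps" "snd p \<noteq> snd q"
  shows "\<exists>k. 2 \<le> k \<and> k \<le> length ps \<and> contains_copy G (cycle_graph (2 * k))"
  using assms(3-)
proof (induction "length ps" arbitrary: ps p q rule: less_induct)
  case less
  let ?R = "\<lambda>p q. {fst q, snd p} \<in> edges G"
  show ?case
  proof (cases "distinct (map snd ps)")
    case True
    have "card {p, q} \<le> card (set ps)"
      using less.prems by (intro card_mono) auto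
    moreover have "p \<noteq> q" using less.prems by auto
    ultimately have "length ps \<ge> 2"
      using card_length[of ps] by simp
    then show ?thesis
      using contains_cycle_of_distinct_chain[OF assms(1,2) less.prems(1) True less.prems(2-4)] by blast
  next
    case False
    then obtain xs' y ys' zs' where "map snd ps = xs' @ y # ys' @ y # zs'"
      using not_distinct_decomp[of "map snd ps"] by auto
    then obtain xs us where us: "ps = xs @ us" "map snd us = y # ys' @ y # zs'"
      by (auto simp: map_eq_append_conv)
    then obtain u rs where rs: "us = u # rs" "snd u = y" "map snd rs = ys' @ y # zs'"
      by (cases us) auto
    then obtain ys vs where vs: "rs = ys @ vs" "map snd vs = y # zs'"
      by (auto simp: map_eq_append_conv)
    then obtain v zs where "vs = v # zs" "snd v = y"
      by (cases vs) auto
    with us rs vs have ps: "ps = xs @ u # ys @ v # zs" and uv: "snd u = snd v" by auto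
    \<comment> \<open>Both of the following cyclic sequences contain the repeated second component, so in one
      of them the second components are not all equal.\<close>
    let ?as = "ys @ [v]" and ?bs = "xs @ u # zs"
    let ?h = "hd (xs @ [u])"
    have "successively ?R ((xs @ [u]) @ (ys @ [v]) @ (zs @ [?h]))"
      using less.prems(4) unfolding ps by (cases xs) auto
    moreover have "hd ((ys @ [v]) @ zs @ [?h]) = hd (ys @ [v])"
      by (cases ys) auto
    ultimately have parts: "successively ?R (xs @ [u])" "successively ?R (ys @ [v])"
      "successively ?R (zs @ [?h])" "?R v (hd (ys @ [v]))" "?R u (hd (zs @ [?h]))"
      unfolding successively_append_iff[of ?R "xs @ [u]"] successively_append_iff[of ?R "ys @ [v]"]
      by (auto simp: uv)
    have succ_as: "successively ?R (?as @ [hd ?as])"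
      unfolding successively_append_iff[of ?R ?as] using parts by simp
    have "successively ?R ((xs @ [u]) @ (zs @ [?h]))"
      unfolding successively_append_iff[of ?R "xs @ [u]"] using parts by simp
    then have succ_bs: "successively ?R (?bs @ [hd ?bs])"
      by (cases xs) auto
    have dist: "distinct (map fst ?as)" "distinct (map fst ?bs)"
      and sub: "set ?as \<subseteq> B \<times> A" "set ?bs \<subseteq> B \<times> A"
      and edge: "\<forall>p \<in> set ?as. {fst p, snd p} \<in> edges G" "\<forall>p \<in> set ?bs. {fst p, snd p} \<in> edges G"
      and len: "length ?as < length ps" "length ?bs < length ps"
      using less.prems(1-3) unfolding ps by auto
    obtain r where "r \<in> set ps" "snd r \<noteq> snd v"
      using less.prems(5-7) by metis
    then consider p' where "p' \<in> set ?as" "snd p' \<noteq> snd v" | p' where "p' \<in> set ?bs" "snd p' \<noteq> snd u"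
      unfolding ps using uv by (metis Un_iff insert_iff list.set(2) set_append)
    then show ?thesis
    proof cases
      case 1
      then obtain k where "2 \<le> k" "k \<le> length ?as" "contains_copy G (cycle_graph (2 * k))"
        using less.hyps[OF len(1) dist(1) sub(1) edge(1) succ_as, of p' v] by auto
      then show ?thesis using len(1) by (intro exI[of _ k]) auto
    next
      case 2
      then obtain k where "2 \<le> k" "k \<le> length ?bs" "contains_copy G (cycle_graph (2 * k))"
        using less.hyps[OF len(2) dist(2) sub(2) edge(2) succ_bs, of p' u] by auto
      then show ?thesis using len(2) by (intro exI[of _ k]) auto
    qed
  qed
qed

section \<open>Splitting the neighbourhoods\<close>

text \<open>
  The union bound. For uniformly random independent subsets \<open>s x\<close> of \<open>N x\<close>, a fixed set \<open>I\<close> of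
  size \<open>t\<close> is left unsplit in every \<open>N x\<close> with probability at most
  \<open>\<Prod>\<^bsub>x\<^esub> 2 ^ (1 - card (N x \<inter> I)) = 2 ^ (card A - a * t)\<close>. The proof counts the
  families \<open>s\<close> instead of speaking of probabilities.
\<close>
lemma exists_splitting:
  fixes N :: "'a \<Rightarrow> 'b set"
  assumes "finite A" "finite B" and N: "\<And>x. x \<in> A \<Longrightarrow> N x \<subseteq> B"
    and deg: "\<And>y. y \<in> B \<Longrightarrow> card {x \<in> A. y \<in> N x} = a"
    and few: "card B ^ t * 2 ^ card A < (2 :: nat) ^ (a * t)"
  shows "\<exists>s. \<forall>I \<subseteq> B. card I = t \<longrightarrow> (\<exists>x \<in> A. N x \<inter> I \<inter> s x \<noteq> {} \<and> N x \<inter> I - s x \<noteq> {})"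
proof (rule ccontr)
  assume no_s: "\<not> ?thesis"
  define S where "S = (\<Pi>\<^sub>E x \<in> A. Pow (N x))"
  \<comment> \<open>\<open>T I x\<close> consists of the subsets of \<open>N x\<close> that do not split \<open>N x \<inter> I\<close>.\<close>
  define T where "T I x = Pow (N x - I) \<union> (\<lambda>s. s \<union> (N x \<inter> I)) ` Pow (N x - I)" for I x
  define bad where "bad I = (\<Pi>\<^sub>E x \<in> A. T I x)" for I
  define \<I> where "\<I> = {I. I \<subseteq> B \<and> card I = t}"
  have finN: "finite (N x)" if "x \<in> A" for x
    using N[OF that] \<open>finite B\<close> by (rule finite_subset)
  have fin\<I>: "finite \<I>" using \<open>finite B\<close> by (simp add: \<I>_def)
  have card_S: "card S = (\<Prod>x\<in>A. 2 ^ card (N x))"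
    unfolding S_def using \<open>finite A\<close> finN by (simp add: card_PiE card_Pow)
  have card_T: "card (T I x) * 2 ^ card (N x \<inter> I) \<le> 2 ^ card (N x) * 2" if "x \<in> A" for I x
  proof -
    have "card (T I x) \<le> card (Pow (N x - I)) + card (Pow (N x - I))"
      unfolding T_def using finN[OF that]
      by (intro order_trans[OF card_Un_le] add_left_mono card_image_le) simp
    also have "\<dots> = 2 * 2 ^ card (N x - I)"
      using finN[OF that] by (simp add: card_Pow)
    finally have "card (T I x) * 2 ^ card (N x \<inter> I) \<le> 2 * 2 ^ (card (N x - I) + card (N x \<inter> I))"
      by (simp add: power_add)
    moreover have "card (N x - I) + card (N x \<inter> I) = card (N x)"
      using card_Int_Diff[OF finN[OF that], of I] by simp
    ultimately show ?thesis by simp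
  qed
  have card_bad: "card (bad I) * 2 ^ (a * t) \<le> card S * 2 ^ card A" if "I \<in> \<I>" for I
  proof -
    have I: "I \<subseteq> B" "card I = t" "finite I"
      using that \<open>finite B\<close> by (auto simp: \<I>_def intro: finite_subset)
    have "(\<Sum>x\<in>A. card {y \<in> I. y \<in> N x}) = (\<Sum>y\<in>I. a)"
      using \<open>finite A\<close> I deg by (intro sum_multicount_gen) auto
    moreover have "{y \<in> I. y \<in> N x} = N x \<inter> I" for x by auto
    ultimately have sum: "(\<Sum>x\<in>A. card (N x \<inter> I)) = a * t" using I(2) by simp
    have "card (bad I) * 2 ^ (a * t) = (\<Prod>x\<in>A. card (T I x) * 2 ^ card (N x \<inter> I))"
      unfolding bad_def using \<open>finite A\<close>
      by (simp add: card_PiE prod.distrib sum[symmetric] power_sum)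
    also have "\<dots> \<le> (\<Prod>x\<in>A. 2 ^ card (N x) * 2)"
      using card_T by (intro prod_mono) auto
    also have "\<dots> = card S * 2 ^ card A"
      by (simp add: prod.distrib card_S)
    finally show ?thesis .
  qed
  have "S \<subseteq> (\<Union>I\<in>\<I>. bad I)"
  proof
    fix s assume s: "s \<in> S"
    from no_s have "\<not> (\<forall>I \<subseteq> B. card I = t \<longrightarrow>
        (\<exists>x \<in> A. N x \<inter> I \<inter> s x \<noteq> {} \<and> N x \<inter> I - s x \<noteq> {}))"
      by (rule contrapos_nn) (rule exI)
    then obtain I where I: "I \<in> \<I>"
      "\<And>x. x \<in> A \<Longrightarrow> N x \<inter> I \<inter> s x = {} \<or> N x \<inter> I - s x = {}"
      unfolding \<I>_def by (metis (mono_tags, lifting) mem_Collect_eq)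
    have "s x \<in> T I x" if x: "x \<in> A" for x
    proof -
      have sub: "s x \<subseteq> N x" using s x by (auto simp: S_def)
      show ?thesis
      proof (cases "N x \<inter> I \<inter> s x = {}")
        case True
        then show ?thesis using sub by (auto simp: T_def)
      next
        case False
        then have "s x = (s x - I) \<union> (N x \<inter> I)" "s x - I \<in> Pow (N x - I)"
          using I(2)[OF x] sub by auto
        then show ?thesis unfolding T_def by blast
      qed
    qed
    then have "s \<in> bad I" using s by (auto simp: bad_def S_def PiE_iff)
    then show "s \<in> (\<Union>I\<in>\<I>. bad I)" using I(1) by blast
  qed
  moreover have "finite (\<Union>I\<in>\<I>. bad I)"
    using fin\<I> finN \<open>finite A\<close> by (auto simp: bad_def T_def intro!: finite_PiE)
  ultimately have "card S \<le> card (\<Union>I\<in>\<I>. bad I)" by (rule card_mono[rotated])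
  also have "\<dots> \<le> (\<Sum>I\<in>\<I>. card (bad I))" using fin\<I> by (rule card_UN_le)
  finally have "card S * 2 ^ (a * t) \<le> (\<Sum>I\<in>\<I>. card (bad I) * 2 ^ (a * t))"
    by (simp flip: sum_distrib_right)
  also have "\<dots> \<le> card \<I> * (card S * 2 ^ card A)"
    using card_bad sum_bounded_above[of \<I> "\<lambda>I. card (bad I) * 2 ^ (a * t)" "card S * 2 ^ card A"]
    by simp
  also have "\<dots> \<le> card B ^ t * (card S * 2 ^ card A)"
  proof (rule mult_right_mono)
    have "card \<I> = card B choose t"
      unfolding \<I>_def using \<open>finite B\<close> by (rule n_subsets)
    then show "card \<I> \<le> card B ^ t"
      by (cases "t \<le> card B") (auto simp: binomial_le_pow binomial_eq_0)
  qed simp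
  finally have "card S * 2 ^ (a * t) \<le> card S * (card B ^ t * 2 ^ card A)"
    by (simp add: mult_ac)
  moreover have "card S > 0" by (simp add: card_S prod_pos)
  ultimately show False using few by simp
qed

text \<open>
  Join two vertices of \<open>B\<close> if they have a common neighbour \<open>x\<close> and lie on different sides of the
  splitting of the neighbourhood of \<open>x\<close>. An odd cycle in this graph cannot stay inside one
  neighbourhood, because each neighbourhood contributes a bipartite graph; so it would lift to a
  cycle in \<open>G\<close> of at most twice its length.
\<close>
lemma ramsey_number_greater_of_bipartite:
  fixes G :: "'a ugraph"
  assumes k: "odd k" "k \<ge> 2"
    and G: "simple_graph G" and girth: "girth G > enat (2 * k)"
    and V: "A \<union> B = vertices G" "A \<inter> B = {}"
    and bip: "\<And>e. e \<in> edges G \<Longrightarrow> \<exists>x\<in>A. \<exists>y\<in>B. e = {x, y}"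
    and deg: "\<And>y. y \<in> B \<Longrightarrow> vertex_degree G y = a"
    and few: "card B ^ t * 2 ^ card A < (2 :: nat) ^ (a * t)"
  shows "ramsey_number (cycle_graph k) t > card B"
proof -
  define N where "N x = {y \<in> B. {y, x} \<in> edges G}" for x
  have "finite (A \<union> B)" using G V(1) by (simp add: simple_graph_def)
  then have fin: "finite A" "finite B" by auto
  have degN: "card {x \<in> A. y \<in> N x} = a" if "y \<in> B" for y
  proof -
    have "bij_betw (\<lambda>x. {y, x}) {x \<in> A. y \<in> N x} {e \<in> edges G. y \<in> e}"
    proof (rule bij_betw_imageI)
      show "inj_on (\<lambda>x. {y, x}) {x \<in> A. y \<in> N x}"
        by (auto simp: inj_on_def doubleton_eq_iff)
      have "e \<in> (\<lambda>x. {y, x}) ` {x \<in> A. y \<in> N x}" if e: "e \<in> edges G" "y \<in> e" for e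
      proof -
        obtain x y' where "x \<in> A" "y' \<in> B" "e = {x, y'}" using bip[OF e(1)] by blast
        moreover from this have "y = y'" using e(2) V(2) \<open>y \<in> B\<close> by auto
        ultimately show ?thesis using e by (auto simp: N_def insert_commute)
      qed
      then show "(\<lambda>x. {y, x}) ` {x \<in> A. y \<in> N x} = {e \<in> edges G. y \<in> e}"
        by (auto simp: N_def)
    qed
    then show ?thesis
      using deg[OF that] by (simp add: bij_betw_same_card vertex_degree_def)
  qed
  obtain s where s: "\<And>I. I \<subseteq> B \<Longrightarrow> card I = t \<Longrightarrow>
      \<exists>x \<in> A. N x \<inter> I \<inter> s x \<noteq> {} \<and> N x \<inter> I - s x \<noteq> {}"
    using exists_splitting[of A B N a t] fin degN few by (auto simp: N_def)
  \<comment> \<open>The set \<open>s x\<close> meets \<open>N x\<close> in one of the two sides into which \<open>N x\<close> is split.\<close>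
  define H where "H = (B, {{u, v} |u v. \<exists>x\<in>A. u \<in> N x \<and> v \<in> N x \<and> u \<in> s x \<and> v \<notin> s x})"
  have "simple_graph H"
    using fin by (auto simp: simple_graph_def H_def N_def nsets_def card_2_iff)
  moreover have "\<not> contains_copy H (cycle_graph k)"
  proof
    assume "contains_copy H (cycle_graph k)"
    then obtain f where f: "inj_on f {..<k}" "f ` {..<k} \<subseteq> B"
      and edges: "\<forall>e \<in> edges (cycle_graph k). f ` e \<in> edges H"
      by (auto simp: contains_copy_def cycle_graph_def H_def)
    have f_edge: "{f i, f (Suc i mod k)} \<in> edges H" if "i < k" for i
    proof -
      have "{i, Suc i mod k} \<in> edges (cycle_graph k)"
        using that by (auto simp: cycle_graph_def)
      then have "f ` {i, Suc i mod k} \<in> edges H" using edges by blast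
      then show ?thesis by simp
    qed
    have "\<exists>x. x \<in> A \<and> f i \<in> N x \<and> f (Suc i mod k) \<in> N x \<and>
        (f i \<in> s x \<longleftrightarrow> f (Suc i mod k) \<notin> s x)" if i: "i < k" for i
    proof -
      obtain u v x where "{f i, f (Suc i mod k)} = {u, v}" "x \<in> A" "u \<in> N x" "v \<in> N x"
        "u \<in> s x" "v \<notin> s x"
        using f_edge[OF i] by (auto simp: H_def)
      then show ?thesis by (intro exI[of _ x]) (auto simp: doubleton_eq_iff)
    qed
    then obtain c where c: "\<And>i. i < k \<Longrightarrow> c i \<in> A \<and> f i \<in> N (c i) \<and> f (Suc i mod k) \<in> N (c i) \<and>
        (f i \<in> s (c i) \<longleftrightarrow> f (Suc i mod k) \<notin> s (c i))"
      by metis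
    define x where "x = c 0"
    show False
    proof (cases "\<forall>i<k. c i = x")
      case True
      \<comment> \<open>Then membership in \<open>s x\<close> alternates along the cycle, which is impossible for odd \<open>k\<close>.\<close>
      have same: "f i \<in> s x \<longleftrightarrow> f (Suc i mod k) \<notin> s x" if "i < k" for i
        using c[OF that] True that by simp
      have "f i \<in> s x \<longleftrightarrow> (even i \<longleftrightarrow> f 0 \<in> s x)" if "i < k" for i
        using that
      proof (induction i)
        case (Suc i)
        then show ?case using same[of i] by auto
      qed simp
      from this[of "k - 1"] same[of "k - 1"] show False
        using k by simp
    next
      case False
      then obtain j where j: "j < k" "c j \<noteq> c 0" by (auto simp: x_def)
      define ps where "ps = map (\<lambda>i. (f i, c i)) [0..<k]"
      have "ps @ [hd ps] = map (\<lambda>i. (f (i mod k), c (i mod k))) [0..<Suc k]"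
        using k by (simp add: ps_def hd_map)
      then have "successively (\<lambda>p q. {fst q, snd p} \<in> edges G) (ps @ [hd ps])"
        using c by (simp add: successively_conv_nth N_def del: upt_Suc)
      moreover have "distinct (map fst ps)"
        using f(1) by (simp add: ps_def distinct_map comp_def atLeast0LessThan)
      moreover have "set ps \<subseteq> B \<times> A" "\<forall>p \<in> set ps. {fst p, snd p} \<in> edges G"
        using c f(2) by (auto simp: ps_def N_def)
      moreover have "(f 0, c 0) \<in> set ps" "(f j, c j) \<in> set ps"
        using j k by (auto simp: ps_def)
      ultimately obtain q where q: "2 \<le> q" "q \<le> k" "contains_copy G (cycle_graph (2 * q))"
        using short_cycle_of_closed_chain[of A B G ps "(f 0, c 0)" "(f j, c j)"] V j
        by (auto simp: ps_def)
      then have "girth G \<le> enat (2 * q)"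
        unfolding girth_def by (intro Inf_lower) auto
      also have "\<dots> \<le> enat (2 * k)" using q by simp
      finally show False using girth by simp
    qed
  qed
  moreover have "\<not> indep I (edges H)" if I: "I \<subseteq> vertices H" "card I = t" for I
  proof -
    obtain x u v where x: "x \<in> A" "u \<in> N x \<inter> I \<inter> s x" "v \<in> N x \<inter> I - s x"
      using s[of I] I by (auto simp: H_def)
    then have "{u, v} \<in> edges H" "u \<noteq> v" by (auto simp: H_def)
    then show ?thesis using x by (auto simp: indep_def)
  qed
  ultimately show ?thesis
    using ramsey_number_greater[of "cycle_graph k" H t] simple_graph_cycle_graph[OF k(2)]
    by (simp add: H_def)
qed

section \<open>Choice of the order of the independent set\<close>

text \<open>
  With \<open>b = a powr \<beta>\<close>, the lower bound on the number \<open>n * a = m * b\<close> of edges amounts to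
  \<open>n \<le> C * a powr (l + \<beta> * (l + 1))\<close> for a constant \<open>C\<close>. As \<open>\<beta>\<close> is bounded by \<open>K\<close>, this makes \<open>a\<close> at least a
  fixed positive power of \<open>n\<close>, which yields \<open>n ^ 2 \<le> 2 ^ a\<close>; then every \<open>t > 2 * n / b = 2 * m / a\<close>
  satisfies the counting condition. The least such \<open>t\<close> is at most a constant times \<open>n powr (1 - \<gamma>)\<close>
  with \<open>\<gamma> = \<beta> / (l + \<beta> * (l + 1))\<close>, and \<open>1 - \<gamma>\<close> tends to \<open>l / (l + 1)\<close> as \<open>\<beta>\<close> grows.
\<close>
lemma eventually_parameters:
  fixes l :: nat and c K \<epsilon> :: real
  assumes l: "l \<ge> 1" and c: "c > 0" and \<epsilon>: "\<epsilon> > 0" and K: "K > 0"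
  shows "eventually (\<lambda>n. \<forall>m a b. 2 \<le> a \<and> a \<le> b \<and> b \<le> n \<and> n * a = m * b \<and>
      real (n * a) \<ge> c * (real m * real n) powr (real (l + 1) / real (2 * l + 1)) \<and>
      4 / \<epsilon> \<le> log (real a) (real b) \<and> log (real a) (real b) \<le> K \<longrightarrow>
      (\<exists>t\<ge>2. n ^ t * 2 ^ m < (2 :: nat) ^ (a * t) \<and>
         real t powr (real (l + 1) / real l - \<epsilon>) \<le> real n)) sequentially"
proof -
  define L where "L = real l"
  define D where "D = L + K * (L + 1)"
  define c' where "c' = min 1 c ^ (2 * l + 1)"
  define \<theta> where "\<theta> = real (l + 1) / real l - \<epsilon>"
  define C where "C = (4 / c') powr \<theta>"
  have L: "L \<ge> 1" using l by (simp add: L_def)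
  have D: "D > 0" using L K by (simp add: D_def add_pos_pos)
  have c': "0 < c'" "c' \<le> 1" "c' \<le> c ^ (2 * l + 1)"
    unfolding c'_def using c by (simp, intro power_le_one, auto intro!: power_mono simp del: power_Suc)
  have "eventually (\<lambda>n. real n ^ 2 \<le> 2 powr ((c' * real n) powr (1 / D))) sequentially"
    using c' D by real_asymp
  moreover have "eventually (\<lambda>n. C \<le> real n powr (\<epsilon> / 4)) sequentially"
    using \<epsilon> by real_asymp
  moreover have "eventually (\<lambda>n. c' * real n \<ge> 1) sequentially"
    using c' by real_asymp
  moreover have "eventually (\<lambda>n. n \<ge> (1::nat)) sequentially"
    by (rule eventually_ge_at_top)
  ultimately show ?thesis
  proof eventually_elim
    case (elim n)
    show ?case
    proof (intro allI impI, elim conjE)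
      fix m a b
      assume a: "2 \<le> a" and ab: "a \<le> b" and bn: "b \<le> n" and nm: "n * a = m * b"
        and ed: "c * (real m * real n) powr (real (l + 1) / real (2 * l + 1)) \<le> real (n * a)"
        and lo: "4 / \<epsilon> \<le> log (real a) (real b)" and hi: "log (real a) (real b) \<le> K"
      define \<beta> where "\<beta> = log (real a) (real b)"
      have n: "n > 0" and b: "b > 0" using a ab bn by auto
      have m: "m > 0" using nm n a by (cases m) auto
      have nm': "real n * real a = real m * real b"
        using nm by (metis of_nat_mult)
      have \<beta>: "\<beta> > 0" "\<epsilon> * \<beta> \<ge> 4" "\<beta> \<le> K"
        using lo hi \<epsilon> order_less_le_trans[of 0 "4 / \<epsilon>"] by (auto simp: \<beta>_def field_simps)
      have b_eq: "real b = real a powr \<beta>"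
        unfolding \<beta>_def using a b by (simp add: powr_log_cancel)
      define E where "E = L + \<beta> * (L + 1)"
      have E: "E > 0" "E \<le> D"
        using L \<beta> by (auto simp: E_def D_def add_pos_pos intro!: mult_right_mono)

      \<comment> \<open>Raise the edge bound to the power \<open>2 * l + 1\<close>, substitute \<open>m * b = n * a\<close> and cancel.\<close>
      have "(c * (real m * real n) powr (real (l + 1) / real (2 * l + 1))) ^ (2 * l + 1)
             \<le> real (n * a) ^ (2 * l + 1)"
        using ed c by (intro power_mono) auto
      moreover have "((real m * real n) powr (real (l + 1) / real (2 * l + 1))) ^ (2 * l + 1)
          = (real m * real n) ^ (l + 1)"
      proof -
        have "(x powr r) ^ (2 * l + 1) = x powr (r * real (2 * l + 1))" if "x > 0" for x r :: real
          using that powr_realpow[of "x powr r" "2 * l + 1"] by (simp only: powr_powr powr_gt_zero)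
        moreover have "real (l + 1) / real (2 * l + 1) * real (2 * l + 1) = real (l + 1)" by simp
        ultimately show ?thesis
          using m n powr_realpow[of "real m * real n" "l + 1"] by simp
      qed
      ultimately have "c ^ (2 * l + 1) * (real m * real n) ^ (l + 1)
             \<le> (real n * real a) ^ (2 * l + 1)"
        by (simp only: power_mult_distrib of_nat_mult)
      then have "c' * (real m * real n) ^ (l + 1) \<le> (real n * real a) ^ (2 * l + 1)"
        using c'(3) by (smt (verit) mult_right_mono zero_le_power mult_nonneg_nonneg of_nat_0_le_iff)
      then have "c' * (real m * real n) ^ (l + 1) * real b ^ (l + 1)
             \<le> (real n * real a) ^ (2 * l + 1) * real b ^ (l + 1)"
        by (intro mult_right_mono) auto
      also have "c' * (real m * real n) ^ (l + 1) * real b ^ (l + 1)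
          = c' * (real m * real b) ^ (l + 1) * real n ^ (l + 1)"
        by (simp only: power_mult_distrib mult_ac)
      also have "\<dots> = (c' * real n) * (real n ^ l * (real n * real a) ^ (l + 1))"
        unfolding nm'[symmetric] by (simp only: power_add power_one_right mult_ac)
      also have "(real n * real a) ^ (2 * l + 1) * real b ^ (l + 1)
          = (real a ^ l * real b ^ (l + 1)) * (real n ^ l * (real n * real a) ^ (l + 1))"
        by (simp only: power_mult_distrib mult_2 mult_2_right power_add power_one_right mult_ac)
      finally have "c' * real n \<le> real a ^ l * real b ^ (l + 1)"
        using n a by (subst (asm) mult_le_cancel_right_pos) auto
      also have "\<dots> = real a powr E"
      proof -
        have "real a ^ l = real a powr L"
          using a by (simp add: L_def powr_realpow)
        moreover have "real b ^ (l + 1) = real b powr (L + 1)"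
          using b powr_realpow[of "real b" "l + 1"] by (simp add: L_def add.commute)
        moreover have "real b powr (L + 1) = real a powr (\<beta> * (L + 1))"
          by (simp only: b_eq powr_powr)
        ultimately show ?thesis by (simp only: E_def powr_add)
      qed
      finally have key: "c' * real n \<le> real a powr E" .

      have "(c' * real n) powr (1 / D) \<le> (real a powr D) powr (1 / D)"
        using key E a c' D by (intro powr_mono2 order_trans[OF key] powr_mono) auto
      also have "\<dots> = real a" using D a by (simp add: powr_powr)
      finally have "2 powr ((c' * real n) powr (1 / D)) \<le> 2 powr real a" by simp
      with elim(1) have "real n ^ 2 \<le> 2 ^ a" by (simp add: powr_realpow)
      then have n2: "n ^ 2 \<le> 2 ^ a"
        by (metis of_nat_le_iff of_nat_numeral of_nat_power)

      \<comment> \<open>The least integer exceeding \<open>2 * n / b\<close>.\<close>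
      define t where "t = 2 * n div b + 1"
      have t2: "t \<ge> 2"
        using bn b by (simp add: t_def Suc_le_eq div_greater_zero_iff)
      have "2 * n < b * t"
        using b dividend_less_times_div[of b "2 * n"] by (simp add: t_def)
      then have "2 * n * a < b * t * a" using a by simp
      moreover have "2 * n * a = (2 * m) * b" using nm by simp
      moreover have "b * t * a = (t * a) * b" by (simp only: mult_ac)
      ultimately have "(2 * m) * b < (t * a) * b" by (simp only:)
      then have mt: "2 * m < t * a" by simp
      have "(n ^ t * 2 ^ m) ^ 2 = (n ^ 2) ^ t * 2 ^ (2 * m)"
        by (simp add: power_mult_distrib mult.commute flip: power_mult)
      also have "\<dots> \<le> (2 ^ a) ^ t * 2 ^ (2 * m)"
        using n2 by (intro mult_right_mono power_mono) auto
      also have "\<dots> < (2 ^ a) ^ t * 2 ^ (t * a)"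
        using mt by (intro mult_strict_left_mono power_strict_increasing) auto
      also have "\<dots> = ((2::nat) ^ (a * t)) ^ 2"
        by (simp add: power2_eq_square mult.commute flip: power_mult)
      finally have count: "n ^ t * 2 ^ m < (2::nat) ^ (a * t)"
        by (rule power_less_imp_less_base) simp

      define \<gamma> where "\<gamma> = \<beta> / E"
      have \<gamma>: "0 < \<gamma>" "\<gamma> \<le> 1"
        using \<beta> E L by (auto simp: \<gamma>_def E_def field_simps)
      have "c' * real n powr \<gamma> \<le> c' powr \<gamma> * real n powr \<gamma>"
        using c' \<gamma> powr_mono'[of \<gamma> 1 c'] by (intro mult_right_mono) auto
      also have "\<dots> = (c' * real n) powr \<gamma>" using c' by (simp add: powr_mult)
      also have "\<dots> \<le> (real a powr E) powr \<gamma>"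
        using key c' \<gamma> by (intro powr_mono2) auto
      also have "\<dots> = real b" using E by (simp add: powr_powr \<gamma>_def b_eq)
      finally have b_ge: "c' * real n powr \<gamma> \<le> real b" .
      have "real t \<le> 2 * real n / real b + 1"
        using of_nat_div_le_of_nat[of "2 * n" b, where 'a = real] by (simp add: t_def)
      also have "\<dots> \<le> 4 * real n / real b"
        using bn b by (simp add: field_simps)
      also have "\<dots> \<le> 4 * real n / (c' * real n powr \<gamma>)"
        using b_ge c' n b by (intro divide_left_mono) auto
      also have "\<dots> = (4 / c') * real n powr (1 - \<gamma>)"
        using n by (simp add: powr_diff)
      finally have t_le: "real t \<le> (4 / c') * real n powr (1 - \<gamma>)" .
      have "real t powr \<theta> \<le> real n"
      proof (cases "\<theta> \<le> 0")
        case True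
        then have "real t powr \<theta> \<le> real t powr 0" using t2 by (intro powr_mono) auto
        then show ?thesis using t2 n by simp
      next
        case False
        have "(1 - \<gamma>) * \<theta> = ((L + 1) - \<epsilon> * L) * (1 + \<beta>) / E"
        proof -
          have "1 - \<gamma> = L * (1 + \<beta>) / E" using E by (simp add: \<gamma>_def E_def field_simps)
          moreover have "\<theta> = ((L + 1) - \<epsilon> * L) / L" using L by (simp add: \<theta>_def L_def field_simps)
          ultimately show ?thesis using L by simp
        qed
        also have "\<dots> \<le> 1 - \<epsilon> / 4"
        proof -
          have "L + \<beta> * L + \<beta> \<le> 2 * (L * (1 + \<beta>))"
          proof -
            have "\<beta> * 1 \<le> \<beta> * L" using L \<beta> by (intro mult_left_mono) auto
            then show ?thesis using L by (simp add: algebra_simps)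
          qed
          then have "\<epsilon> * (L + \<beta> * L + \<beta>) \<le> \<epsilon> * (2 * (L * (1 + \<beta>)))"
            using \<epsilon> by (intro mult_left_mono) auto
          moreover have "2 \<le> \<epsilon> * (L * (1 + \<beta>))"
          proof -
            have "\<epsilon> * \<beta> \<le> \<epsilon> * (L * (1 + \<beta>))"
              using \<epsilon> \<beta> L mult_mono[of 1 L \<beta> "1 + \<beta>"] by (intro mult_left_mono) auto
            then show ?thesis using \<beta> by linarith
          qed
          moreover have "(1 - \<epsilon> / 4) * E - ((L + 1) - \<epsilon> * L) * (1 + \<beta>)
              = \<epsilon> * (L * (1 + \<beta>)) - 1 - \<epsilon> * (L + \<beta> * L + \<beta>) / 4"
            by (simp add: E_def field_simps)
          ultimately have "((L + 1) - \<epsilon> * L) * (1 + \<beta>) \<le> (1 - \<epsilon> / 4) * E"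
            by linarith
          then show ?thesis using E by (simp add: pos_divide_le_eq)
        qed
        finally have ex: "(1 - \<gamma>) * \<theta> \<le> 1 - \<epsilon> / 4" .
        have "real t powr \<theta> \<le> ((4 / c') * real n powr (1 - \<gamma>)) powr \<theta>"
          using t_le False by (intro powr_mono2) auto
        also have "\<dots> = C * real n powr ((1 - \<gamma>) * \<theta>)"
          unfolding C_def by (simp only: powr_mult powr_powr)
        \<comment> \<open>The margin \<open>\<epsilon> / 4\<close> absorbs the constant \<open>C\<close>.\<close>
        also have "\<dots> \<le> real n powr (\<epsilon> / 4) * real n powr (1 - \<epsilon> / 4)"
          using elim(2) ex n by (intro mult_mono powr_mono) auto
        also have "\<dots> = real n" using n by (simp flip: powr_add)
        finally show ?thesis .
      qed
      then show "\<exists>t\<ge>2. n ^ t * 2 ^ m < (2 :: nat) ^ (a * t) \<and>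
         real t powr (real (l + 1) / real l - \<epsilon>) \<le> real n"
        using t2 count unfolding \<theta>_def by blast
    qed
  qed
qed

section \<open>Ramsey numbers of odd cycles\<close>

lemma card_edges_eq_degree_sum:
  assumes G: "simple_graph G" and "finite X" and one: "\<And>e. e \<in> edges G \<Longrightarrow> \<exists>!x. x \<in> X \<and> x \<in> e"
    and deg: "\<And>x. x \<in> X \<Longrightarrow> vertex_degree G x = d"
  shows "card (edges G) = card X * d"
proof -
  have fin: "finite (edges G)"
    using G finite_subset finite_imp_finite_nsets by (auto simp: simple_graph_def)
  have "edges G = (\<Union>x\<in>X. {e \<in> edges G. x \<in> e})" using one by blast
  also have "card \<dots> = (\<Sum>x\<in>X. card {e \<in> edges G. x \<in> e})"
  proof (rule card_UN_disjoint)
    show "\<forall>x\<in>X. \<forall>y\<in>X. x \<noteq> y \<longrightarrow> {e \<in> edges G. x \<in> e} \<inter> {e \<in> edges G. y \<in> e} = {}"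
      using one by blast
  qed (use fin \<open>finite X\<close> in auto)
  also have "\<dots> = card X * d"
    using deg by (simp add: vertex_degree_def)
  finally show ?thesis .
qed

theorem theorem4:
  fixes l :: nat and \<alpha> :: "nat \<Rightarrow> real" and \<epsilon> :: real
  assumes "l \<ge> 1"
    and "\<And>j. j \<ge> 1 \<Longrightarrow> \<alpha> j \<ge> 1"
    and "filterlim \<alpha> at_top sequentially"
    and "\<And>j. j \<ge> 1 \<Longrightarrow>
      \<exists>c > 0. \<exists>(G :: nat \<Rightarrow> 'a ugraph) (m :: nat \<Rightarrow> nat) (n :: nat \<Rightarrow> nat)
                (a :: nat \<Rightarrow> nat) (b :: nat \<Rightarrow> nat).
        (\<forall>i \<ge> 1. mnab_graph (m i) (n i) (a i) (b i) (G i) \<and> a i \<ge> 2 \<and>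
           girth (G i) > enat (4 * l + 2) \<and>
           real (card (edges (G i)))
             \<ge> c * (real (m i) * real (n i)) powr (real (l + 1) / real (2 * l + 1))) \<and>
        filterlim n at_top sequentially \<and>
        (\<lambda>i. log (real (a i)) (real (b i))) \<longlonglongrightarrow> \<alpha> j"
    and "\<epsilon> > 0"
  shows "infinite {t :: nat. t \<ge> 2 \<and>
    real (ramsey_number (cycle_graph (2 * l + 1)) t)
      \<ge> real t powr (real (l + 1) / real l - \<epsilon>)}"
proof
  let ?r = "ramsey_number (cycle_graph (2 * l + 1))"
  let ?\<theta> = "real (l + 1) / real l - \<epsilon>"
  \<comment> \<open>The values of the Ramsey number on a finite set of \<open>t\<close> are bounded, whereas the construction
    produces values above \<open>n i\<close>, and \<open>n i\<close> tends to infinity.\<close>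
  assume fin: "finite {t :: nat. t \<ge> 2 \<and> real (?r t) \<ge> real t powr ?\<theta>}" (is "finite ?S")
  \<comment> \<open>The margin of 1 leaves \<open>log (a i) (b i) \<ge> 4 / \<epsilon>\<close> for all large \<open>i\<close>.\<close>
  have "eventually (\<lambda>j. \<alpha> j \<ge> 4 / \<epsilon> + 1) sequentially"
    using assms(3) by (simp add: filterlim_at_top)
  moreover have "eventually (\<lambda>j. j \<ge> (1::nat)) sequentially" by (rule eventually_ge_at_top)
  ultimately have "eventually (\<lambda>j. \<alpha> j \<ge> 4 / \<epsilon> + 1 \<and> j \<ge> 1) sequentially"
    by (rule eventually_conj)
  then obtain j where j: "\<alpha> j \<ge> 4 / \<epsilon> + 1" "j \<ge> 1"
    using eventually_happens trivial_limit_sequentially by blast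
  obtain c and G :: "nat \<Rightarrow> 'a ugraph" and m n a b where c: "c > 0" and
    G: "\<forall>i \<ge> 1. mnab_graph (m i) (n i) (a i) (b i) (G i) \<and> a i \<ge> 2 \<and>
           girth (G i) > enat (4 * l + 2) \<and>
           real (card (edges (G i)))
             \<ge> c * (real (m i) * real (n i)) powr (real (l + 1) / real (2 * l + 1))"
    and n: "filterlim n at_top sequentially"
    and lim: "(\<lambda>i. log (real (a i)) (real (b i))) \<longlonglongrightarrow> \<alpha> j"
    using assms(4)[OF j(2)] by (elim exE conjE) (rule that)
  have graph: "mnab_graph (m i) (n i) (a i) (b i) (G i)" and a2: "a i \<ge> 2"
    and girth: "girth (G i) > enat (4 * l + 2)"
    and dense: "real (card (edges (G i)))
             \<ge> c * (real (m i) * real (n i)) powr (real (l + 1) / real (2 * l + 1))"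
    if "i \<ge> 1" for i
    using G that by simp_all
  have "\<alpha> j + 1 > 0" using assms(2)[OF j(2)] by simp
  note params = eventually_parameters[OF assms(1) c assms(5) this]
  have "eventually (\<lambda>i. log (real (a i)) (real (b i)) > \<alpha> j - 1) sequentially"
    using lim by (rule order_tendstoD) simp
  moreover have "eventually (\<lambda>i. log (real (a i)) (real (b i)) < \<alpha> j + 1) sequentially"
    using lim by (rule order_tendstoD) simp
  moreover have "eventually (\<lambda>i. n i \<ge> Suc (Max (?r ` ?S))) sequentially"
    using n by (simp add: filterlim_at_top)
  moreover have "eventually (\<lambda>i. i \<ge> (1::nat)) sequentially" by (rule eventually_ge_at_top)
  moreover note eventually_compose_filterlim[OF params n]
  ultimately have "eventually (\<lambda>i. False) sequentially"
  proof eventually_elim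
    case (elim i)
    note i = elim(4)
    have simple: "simple_graph (G i)" and ab: "a i \<le> b i"
      using graph[OF i] unfolding mnab_graph_def by simp_all
    obtain A B where V: "A \<union> B = vertices (G i)" "A \<inter> B = {}" "card A = m i" "card B = n i"
      and bip: "\<forall>e\<in>edges (G i). \<exists>x\<in>A. \<exists>y\<in>B. e = {x, y}"
      and degB: "\<forall>y\<in>B. vertex_degree (G i) y = a i"
      and degA: "\<forall>x\<in>A. vertex_degree (G i) x = b i"
      using graph[OF i] unfolding mnab_graph_def by (elim conjE exE) (rule that)
    have "finite (A \<union> B)" using simple V(1) by (simp add: simple_graph_def)
    then have fin': "finite A" "finite B" by auto
    have "\<exists>!x. x \<in> A \<and> x \<in> e" "\<exists>!y. y \<in> B \<and> y \<in> e" if "e \<in> edges (G i)" for e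
      using bspec[OF bip that] V(2) by blast+
    then have cardE: "card (edges (G i)) = n i * a i" "n i * a i = m i * b i"
      using card_edges_eq_degree_sum[OF simple fin'(1) _ bspec[OF degA]]
        card_edges_eq_degree_sum[OF simple fin'(2) _ bspec[OF degB]] V by auto
    have "n i > 0" using elim(3) by simp
    then have "m i * b i > 0" using cardE(2) a2[OF i] by (metis mult_pos_pos less_le_trans pos2)
    then obtain x where x: "x \<in> A" using V(3) by fastforce
    have "e \<in> (\<lambda>y. {x, y}) ` B" if e: "e \<in> edges (G i)" "x \<in> e" for e
    proof -
      obtain x' y where "x' \<in> A" "y \<in> B" "e = {x', y}" using bspec[OF bip e(1)] by blast
      moreover from this have "x = x'" using e(2) V(2) x by auto
      ultimately show ?thesis by simp
    qed
    then have "{e \<in> edges (G i). x \<in> e} \<subseteq> (\<lambda>y. {x, y}) ` B" by blast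
    then have "card {e \<in> edges (G i). x \<in> e} \<le> card B"
      using fin' by (meson card_image_le card_mono finite_imageI le_trans)
    then have bn: "b i \<le> n i" using bspec[OF degA x] V by (simp add: vertex_degree_def)
    have "real (n i * a i) \<ge> c * (real (m i) * real (n i)) powr (real (l + 1) / real (2 * l + 1))"
      using dense[OF i] unfolding cardE(1) .
    then have hyps: "2 \<le> a i \<and> a i \<le> b i \<and> b i \<le> n i \<and> n i * a i = m i * b i \<and>
      real (n i * a i) \<ge> c * (real (m i) * real (n i)) powr (real (l + 1) / real (2 * l + 1)) \<and>
      4 / \<epsilon> \<le> log (real (a i)) (real (b i)) \<and> log (real (a i)) (real (b i)) \<le> \<alpha> j + 1"
      using a2[OF i] ab bn cardE(2) elim(1,2) j(1) by (intro conjI) linarith+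
    obtain t where t: "t \<ge> 2" "n i ^ t * 2 ^ m i < (2::nat) ^ (a i * t)"
      "real t powr ?\<theta> \<le> real (n i)"
      using mp[OF spec[OF spec[OF spec[OF elim(5), of "m i"], of "a i"], of "b i"] hyps] by blast
    have "?r t > card B"
      using ramsey_number_greater_of_bipartite[OF _ _ simple _ V(1,2) bspec[OF bip] bspec[OF degB], of "2 * l + 1" t]
        assms(1) girth[OF i] t(2) V(3,4) by simp
    then have r: "?r t > n i" using V(4) by simp
    then have "t \<in> ?S" using t by simp
    then have "?r t \<le> Max (?r ` ?S)" using fin by (intro Max_ge) auto
    then show False using r elim(3) by simp
  qed
  then show False by simp
qed

end
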